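(* The path component of the zero module in $\mathrm{(fid)}$, with the topology induced by the interleaving distance, is $\mathrm{(ffid)}$.
   Context: Fix a field $\mathbf{k}$. A persistence module is a functor $M:(\mathbb{R},\le)\to \mathrm{Vect}_{\mathbf{k}}$; "persistence module" means isomorphism class. For an interval $J\subset\mathbb{R}$, the interval module $J$ is $\mathbf{k}$ at points of $J$ and $0$ elsewhere, with identity maps between points of $J$ and zero maps otherwise. For $\varepsilon\ge 0$, $M,N$ are $\varepsilon$-interleaved if there are families of linear maps $\varphi_a:M(a)\to N(a+\varepsilon)$ and $\psi_a:N(a)\to M(a+\varepsilon)$, natural in $a\in\mathbb{R}$, with $\psi_{a+\varepsilon}\varphi_a=M(a\le a+2\varepsilon)$ and $\varphi_{a+\varepsilon}\psi_a=N(a\le a+2\varepsilon)$ for all $a$. The interleaving distance is $d_I(M,N)=\inf\{\varepsilon\ge0 : M,N \text{ are } \varepsilon\text{-interleaved}\}$ ($\infty$ if there is none). It is an extended pseudometric; the induced topology has the open balls $B_r(M)=\{N: d_I(M,N)<r\}$, $r>0$, as a base. $\mathrm{(fid)}$: finite direct sums of interval modules (including the zero module); $\mathrm{(ffid)}$: those in $\mathrm{(fid)}$ with all intervals finite (bounded). *)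

theory Defs
  imports "HOL-Analysis.Analysis" "HOL-Algebra.Module"
begin

definition linear_maps ::
    "('k, 'm) ring_scheme \<Rightarrow> ('k, 'v) module \<Rightarrow> ('k, 'w) module \<Rightarrow> ('v \<Rightarrow> 'w) set" where
  "linear_maps K V W =
     {f \<in> carrier V \<rightarrow> carrier W.
        (\<forall>x\<in>carrier V. \<forall>y\<in>carrier V. f (x \<oplus>\<^bsub>V\<^esub> y) = f x \<oplus>\<^bsub>W\<^esub> f y) \<and>
        (\<forall>c\<in>carrier K. \<forall>x\<in>carrier V. f (c \<odot>\<^bsub>V\<^esub> x) = c \<odot>\<^bsub>W\<^esub> f x)}"

text \<open>
  \<open>tr M a b\<close> is the structure map \<open>M(a \<le> b)\<close>; only its values for \<open>a \<le> b\<close> on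
  the carrier of \<open>fib M a\<close> are meaningful. In the fibres, only the additive group and
  the scalar multiplication are meaningful: the fields \<open>mult\<close> and \<open>one\<close> that the
  record type \<open>module\<close> inherits from \<open>ring\<close> are ignored throughout.
\<close>
record ('k, 'v) pmod =
  fib :: "real \<Rightarrow> ('k, 'v) module"
  tr :: "real \<Rightarrow> real \<Rightarrow> 'v \<Rightarrow> 'v"

locale persistence_module = K?: Ring.field K
  for K :: "('k, 'm) ring_scheme" (structure) and M :: "('k, 'v) pmod" +
  assumes fib_vector_space: "Module.module K (fib M a)"
    and tr_linear: "a \<le> b \<Longrightarrow> tr M a b \<in> linear_maps K (fib M a) (fib M b)"
    and tr_refl: "x \<in> carrier (fib M a) \<Longrightarrow> tr M a a x = x"
    and tr_comp: "\<lbrakk>a \<le> b; b \<le> c; x \<in> carrier (fib M a)\<rbrakk>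
      \<Longrightarrow> tr M b c (tr M a b x) = tr M a c x"

definition pmod_iso ::
    "('k, 'm) ring_scheme \<Rightarrow> ('k, 'v) pmod \<Rightarrow> ('k, 'w) pmod \<Rightarrow> bool" where
  "pmod_iso K M N \<longleftrightarrow>
     (\<exists>f. (\<forall>a. f a \<in> linear_maps K (fib M a) (fib N a) \<and>
               bij_betw (f a) (carrier (fib M a)) (carrier (fib N a))) \<and>
          (\<forall>a b. a \<le> b \<longrightarrow>
             (\<forall>x\<in>carrier (fib M a). f b (tr M a b x) = tr N a b (f a x))))"

definition iso_class ::
    "('k, 'm) ring_scheme \<Rightarrow> ('k, 'v) pmod \<Rightarrow> ('k, 'v) pmod set" where
  "iso_class K M = {N. persistence_module K N \<and> pmod_iso K M N}"

definition interleaved ::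
    "('k, 'm) ring_scheme \<Rightarrow> real \<Rightarrow> ('k, 'v) pmod \<Rightarrow> ('k, 'w) pmod \<Rightarrow> bool" where
  "interleaved K \<epsilon> M N \<longleftrightarrow>
     (\<exists>\<phi> \<psi>.
        (\<forall>a. \<phi> a \<in> linear_maps K (fib M a) (fib N (a + \<epsilon>))) \<and>
        (\<forall>a. \<psi> a \<in> linear_maps K (fib N a) (fib M (a + \<epsilon>))) \<and>
        (\<forall>a b. a \<le> b \<longrightarrow> (\<forall>x\<in>carrier (fib M a).
           \<phi> b (tr M a b x) = tr N (a + \<epsilon>) (b + \<epsilon>) (\<phi> a x))) \<and>
        (\<forall>a b. a \<le> b \<longrightarrow> (\<forall>y\<in>carrier (fib N a).
           \<psi> b (tr N a b y) = tr M (a + \<epsilon>) (b + \<epsilon>) (\<psi> a y))) \<and>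
        (\<forall>a. \<forall>x\<in>carrier (fib M a). \<psi> (a + \<epsilon>) (\<phi> a x) = tr M a (a + 2 * \<epsilon>) x) \<and>
        (\<forall>a. \<forall>y\<in>carrier (fib N a). \<phi> (a + \<epsilon>) (\<psi> a y) = tr N a (a + 2 * \<epsilon>) y))"

definition interleaving_dist ::
    "('k, 'm) ring_scheme \<Rightarrow> ('k, 'v) pmod \<Rightarrow> ('k, 'w) pmod \<Rightarrow> ereal" where
  "interleaving_dist K M N = (INF \<epsilon>\<in>{\<epsilon>. 0 \<le> \<epsilon> \<and> interleaved K \<epsilon> M N}. ereal \<epsilon>)"

text \<open>
  The interleaving distance does not depend on the representatives of the isomorphism
  classes, so the image below is a singleton whenever \<open>A\<close> and \<open>B\<close> are such classes.
\<close>
definition class_dist ::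
    "('k, 'm) ring_scheme \<Rightarrow> ('k, 'v) pmod set \<Rightarrow> ('k, 'w) pmod set \<Rightarrow> ereal" where
  "class_dist K A B = the_elem ((\<lambda>(M, N). interleaving_dist K M N) ` (A \<times> B))"

text \<open>The topology on a set \<open>S\<close> of isomorphism classes having the open balls as a base.\<close>
definition interleaving_topology ::
    "('k, 'm) ring_scheme \<Rightarrow> ('k, 'v) pmod set set \<Rightarrow> ('k, 'v) pmod set topology" where
  "interleaving_topology K S =
     topology (arbitrary union_of
       (\<lambda>U. \<exists>A\<in>S. \<exists>r>0. U = {B\<in>S. class_dist K A B < ereal r}))"

definition trivial_space :: "'v \<Rightarrow> ('k, 'v) module" where
  "trivial_space z =
     \<lparr>carrier = {z}, mult = \<lambda>_ _. z, one = z, zero = z, add = \<lambda>_ _. z, smult = \<lambda>_ _. z\<rparr>"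

definition zero_pmod :: "('k, 'v) pmod" where
  "zero_pmod = \<lparr>fib = \<lambda>_. trivial_space undefined, tr = \<lambda>_ _ _. undefined\<rparr>"

definition interval_module :: "('k, 'm) ring_scheme \<Rightarrow> real set \<Rightarrow> ('k, 'k) pmod" where
  "interval_module K J =
     \<lparr>fib = \<lambda>a. if a \<in> J
        then \<lparr>carrier = carrier K, mult = mult K, one = one K, zero = zero K, add = add K,
              smult = mult K\<rparr>
        else trivial_space \<zero>\<^bsub>K\<^esub>,
      tr = \<lambda>a b x. if a \<in> J \<and> b \<in> J then x else \<zero>\<^bsub>K\<^esub>\<rparr>"

text \<open>
  A direct sum over a finite index set, hence with the full product as carrier. Elements
  are functions that take the value \<open>undefined\<close> outside the index set.
\<close>
definition finite_direct_sum :: "'i set \<Rightarrow> ('i \<Rightarrow> ('k, 'v) pmod) \<Rightarrow> ('k, 'i \<Rightarrow> 'v) pmod" where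
  "finite_direct_sum I M =
     \<lparr>fib = \<lambda>a. \<lparr>carrier = (\<Pi>\<^sub>E i\<in>I. carrier (fib (M i) a)),
                 mult = undefined, one = undefined,
                 zero = (\<lambda>i\<in>I. \<zero>\<^bsub>fib (M i) a\<^esub>),
                 add = (\<lambda>x y. \<lambda>i\<in>I. x i \<oplus>\<^bsub>fib (M i) a\<^esub> y i),
                 smult = (\<lambda>c x. \<lambda>i\<in>I. c \<odot>\<^bsub>fib (M i) a\<^esub> x i)\<rparr>,
      tr = \<lambda>a b x. \<lambda>i\<in>I. tr (M i) a b (x i)\<rparr>"

text \<open>
  Isomorphism classes are formed among the modules whose fibres have carriers in
  \<open>nat \<Rightarrow> 'k\<close>. This type contains a copy of every finite-dimensional \<open>K\<close>-vector space, so
  every finite direct sum of interval modules is represented.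
\<close>
definition fid :: "('k, 'm) ring_scheme \<Rightarrow> ('k, nat \<Rightarrow> 'k) pmod set set" where
  "fid K = {iso_class K (finite_direct_sum {..<n} (\<lambda>i. interval_module K (J i))) | n J.
              \<forall>i<n. is_interval (J i) \<and> J i \<noteq> {}}"

definition ffid :: "('k, 'm) ring_scheme \<Rightarrow> ('k, nat \<Rightarrow> 'k) pmod set set" where
  "ffid K = {iso_class K (finite_direct_sum {..<n} (\<lambda>i. interval_module K (J i))) | n J.
              \<forall>i<n. is_interval (J i) \<and> J i \<noteq> {} \<and> bounded (J i)}"

end

theory Submission
  imports Defs
begin

text \<open>
  \<^bold>\<open>The class of zero is joined to every sum of bounded intervals.\<close> Scale all intervals
  by \<open>t \<in> [0, 1]\<close> towards the origin. If the intervals lie in \<open>[-R, R]\<close>, scaling by \<open>t\<close> and by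
  \<open>s\<close> moves each endpoint by at most \<open>\<bar>t - s\<bar> R\<close>, so the resulting interval modules are
  \<open>\<epsilon>\<close>-interleaved for each \<open>\<epsilon> > \<bar>t - s\<bar> R\<close> (\<open>shift_compatible_shrink\<close>), and interleavings of
  the summands add up to one of the sums. At \<open>t = 0\<close> the path must take the value zero rather
  than a sum of one-point intervals. The same estimate covers this value: an interval of length
  less than \<open>2 \<epsilon>\<close> has zero structure maps over distance \<open>2 \<epsilon>\<close>, hence is \<open>\<epsilon>\<close>-interleaved with
  zero. Thus the path is Lipschitz.

  \<^bold>\<open>No path leaves the sums of bounded intervals.\<close> If \<open>M\<close> is such a sum, then \<open>M(a) = 0\<close> for all
  large \<open>\<bar>a\<bar>\<close>. If \<open>N\<close> is \<open>\<epsilon>\<close>-interleaved with \<open>M\<close>, its structure map from \<open>a\<close> to \<open>a + 2 \<epsilon>\<close> factors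
  through \<open>M(a + \<epsilon>)\<close> and so vanishes far out. An unbounded summand of \<open>N\<close> would contain \<open>a\<close> and
  \<open>a + 2 \<epsilon>\<close> with \<open>\<bar>a + \<epsilon>\<bar>\<close> as large as desired, and the structure map would be nonzero
  (\<open>bounded_if_interleaved_with_bounded\<close>). Hence modules at finite distance from a sum of bounded
  intervals are again such sums, whatever the decomposition chosen. A set closed under finite
  distance is open and closed, and a connected set that meets it lies inside it.
\<close>

section \<open>The topology of an extended pseudometric\<close>

text \<open>
  Reflexivity, symmetry and the triangle inequality of an extended pseudometric, phrased through
  strict upper bounds: an infimum of interleaving parameters is below \<open>r\<close> exactly if some
  parameter is, so each bound amounts to an actual interleaving.
\<close>
locale extended_pseudometric =
  fixes S :: "'a set" and d :: "'a \<Rightarrow> 'a \<Rightarrow> ereal"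
  assumes dist_self: "\<lbrakk>x \<in> S; 0 < r\<rbrakk> \<Longrightarrow> d x x < ereal r"
    and dist_sym: "\<lbrakk>x \<in> S; y \<in> S; d x y < ereal r\<rbrakk> \<Longrightarrow> d y x < ereal r"
    and dist_triangle: "\<lbrakk>x \<in> S; y \<in> S; z \<in> S; d x y < ereal r; d y z < ereal s\<rbrakk>
      \<Longrightarrow> d x z < ereal (r + s)"
begin

definition ball_topology :: "'a topology" where
  "ball_topology =
     topology (arbitrary union_of (\<lambda>U. \<exists>x\<in>S. \<exists>r>0. U = {y\<in>S. d x y < ereal r}))"

lemma ball_inside_ball:
  assumes "x \<in> S" "y \<in> S" "d x y < ereal r"
  obtains t where "0 < t" "{z\<in>S. d y z < ereal t} \<subseteq> {z\<in>S. d x z < ereal r}"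
proof -
  obtain r' where r': "d x y < ereal r'" "ereal r' < ereal r"
    using ereal_dense2[OF assms(3)] by blast
  have "{z\<in>S. d y z < ereal (r - r')} \<subseteq> {z\<in>S. d x z < ereal r}"
    using dist_triangle[OF assms(1,2) _ r'(1)] by fastforce
  moreover have "0 < r - r'" using r'(2) by simp
  ultimately show thesis using that by blast
qed

lemma openin_ball_topology:
  "openin ball_topology U \<longleftrightarrow> U \<subseteq> S \<and> (\<forall>x\<in>U. \<exists>r>0. {y\<in>S. d x y < ereal r} \<subseteq> U)"
proof -
  let ?P = "\<lambda>U. \<exists>x\<in>S. \<exists>r>0. U = {y\<in>S. d x y < ereal r}"
  have base: "(arbitrary union_of ?P) V \<longleftrightarrow> V \<subseteq> S \<and> (\<forall>x\<in>V. \<exists>r>0. {y\<in>S. d x y < ereal r} \<subseteq> V)"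
    (is "?L V \<longleftrightarrow> ?R V") for V
  proof
    assume L: "?L V"
    have "x \<in> S \<and> (\<exists>r>0. {y\<in>S. d x y < ereal r} \<subseteq> V)" if x: "x \<in> V" for x
    proof -
      obtain W where W: "?P W" "x \<in> W" "W \<subseteq> V"
        using L x unfolding arbitrary_union_of_alt by meson
      then obtain c r where c: "c \<in> S" "W = {y\<in>S. d c y < ereal r}" by metis
      then have x: "x \<in> S" "d c x < ereal r" using W(2) by auto
      obtain t where "0 < t" "{y\<in>S. d x y < ereal t} \<subseteq> W"
        using ball_inside_ball[OF c(1) x] c(2) by metis
      then show ?thesis using x(1) W(3) by (meson order_trans)
    qed
    then show "?R V" by blast
  next
    assume R: "?R V"
    show "?L V"
      unfolding arbitrary_union_of_alt
    proof
      fix x assume x: "x \<in> V"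
      then obtain r where r: "0 < r" "{y\<in>S. d x y < ereal r} \<subseteq> V" and xS: "x \<in> S" using R by blast
      have "x \<in> {y\<in>S. d x y < ereal r}" using dist_self xS r(1) by blast
      then show "\<exists>W. ?P W \<and> x \<in> W \<and> W \<subseteq> V" using r xS by blast
    qed
  qed
  have "istopology (arbitrary union_of ?P)"
    unfolding istopology_base_alt
  proof (intro allI impI)
    fix V W assume "(arbitrary union_of ?P) V \<and> (arbitrary union_of ?P) W"
    then have VW: "?R V" "?R W" using base by blast+
    have "\<exists>r>0. {y\<in>S. d x y < ereal r} \<subseteq> V \<inter> W" if x: "x \<in> V \<inter> W" for x
    proof -
      obtain r s where r: "0 < r" "{y\<in>S. d x y < ereal r} \<subseteq> V"
        and s: "0 < s" "{y\<in>S. d x y < ereal s} \<subseteq> W"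
        using VW x by (meson IntD1 IntD2)
      have "{y\<in>S. d x y < ereal (min r s)} \<subseteq> V \<inter> W"
      proof
        fix y assume "y \<in> {y\<in>S. d x y < ereal (min r s)}"
        then have y: "y \<in> S" "d x y < ereal (min r s)" by auto
        have "d x y < ereal r" "d x y < ereal s"
          using y(2) by (auto elim!: less_le_trans)
        then show "y \<in> V \<inter> W" using r(2) s(2) y(1) by blast
      qed
      then show ?thesis using r(1) s(1) by (metis min_less_iff_conj)
    qed
    then show "(arbitrary union_of ?P) (V \<inter> W)" unfolding base using VW by blast
  qed
  then show ?thesis
    unfolding ball_topology_def by (simp only: topology_inverse' base)
qed

lemma topspace_ball_topology: "topspace ball_topology = S"
proof
  show "topspace ball_topology \<subseteq> S"
    by (auto simp: topspace_def openin_ball_topology)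
  have "openin ball_topology S"
    unfolding openin_ball_topology by (auto intro!: exI[of _ 1])
  then show "S \<subseteq> topspace ball_topology" by (rule openin_subset)
qed

text \<open>
  By symmetry the complement is closed under finite distance as well, so every ball around a
  point, of any radius, stays on the side of that point.
\<close>
lemma clopen_if_closed_under_finite_distance:
  assumes "U \<subseteq> S" and fin: "\<And>x y r. \<lbrakk>x \<in> U; y \<in> S; d x y < ereal r\<rbrakk> \<Longrightarrow> y \<in> U"
  shows "openin ball_topology U" "closedin ball_topology U"
proof -
  show "openin ball_topology U"
    unfolding openin_ball_topology using assms by (auto intro!: exI[of _ 1])
  have "{y\<in>S. d x y < ereal 1} \<subseteq> S - U" if "x \<in> S - U" for x
    using that assms(1) dist_sym fin by blast
  then have "openin ball_topology (S - U)"
    unfolding openin_ball_topology using zero_less_one by blast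
  then show "closedin ball_topology U"
    using assms(1) by (simp add: closedin_def topspace_ball_topology)
qed

lemma pathin_ball_topologyI:
  fixes g :: "real \<Rightarrow> 'a"
  assumes gS: "\<And>t. t \<in> {0..1} \<Longrightarrow> g t \<in> S"
    and cont: "\<And>t r. \<lbrakk>t \<in> {0..1}; 0 < r\<rbrakk>
      \<Longrightarrow> \<exists>\<delta>>0. \<forall>s\<in>{0..1}. \<bar>s - t\<bar> < \<delta> \<longrightarrow> d (g t) (g s) < ereal r"
  shows "pathin ball_topology g"
  unfolding pathin_def continuous_map_def
proof (intro conjI allI impI)
  show "g \<in> topspace (top_of_set {0..1}) \<rightarrow> topspace ball_topology"
    using gS by (auto simp: topspace_ball_topology)
  fix U assume U: "openin ball_topology U"
  have "\<exists>e>0. \<forall>s\<in>{0..1}. dist s t < e \<longrightarrow> g s \<in> U" if t: "t \<in> {0..1}" "g t \<in> U" for t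
  proof -
    obtain r where r: "0 < r" "{y\<in>S. d (g t) y < ereal r} \<subseteq> U"
      using U t(2) unfolding openin_ball_topology by blast
    obtain \<delta> where \<delta>: "0 < \<delta>" "\<forall>s\<in>{0..1}. \<bar>s - t\<bar> < \<delta> \<longrightarrow> d (g t) (g s) < ereal r"
      using cont[OF t(1) r(1)] by blast
    have "g s \<in> U" if "s \<in> {0..1}" "dist s t < \<delta>" for s
      using \<delta>(2) that gS[OF that(1)] r(2) by (auto simp: dist_real_def)
    then show ?thesis using \<delta>(1) by blast
  qed
  then show "openin (top_of_set {0..1}) {t \<in> topspace (top_of_set {0..1}). g t \<in> U}"
    unfolding openin_euclidean_subtopology_iff by auto
qed

end

section \<open>Linear maps and isomorphisms\<close>

lemma linear_mapsD:
  assumes "f \<in> linear_maps K V W"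
  shows "x \<in> carrier V \<Longrightarrow> f x \<in> carrier W"
    and "\<lbrakk>x \<in> carrier V; y \<in> carrier V\<rbrakk> \<Longrightarrow> f (x \<oplus>\<^bsub>V\<^esub> y) = f x \<oplus>\<^bsub>W\<^esub> f y"
    and "\<lbrakk>c \<in> carrier K; x \<in> carrier V\<rbrakk> \<Longrightarrow> f (c \<odot>\<^bsub>V\<^esub> x) = c \<odot>\<^bsub>W\<^esub> f x"
  using assms unfolding linear_maps_def by auto

lemma linear_maps_compose:
  assumes "f \<in> linear_maps K U V" "g \<in> linear_maps K V W"
  shows "(\<lambda>x. g (f x)) \<in> linear_maps K U W"
  using assms unfolding linear_maps_def by (auto simp: Pi_iff)

lemma linear_maps_id: "(\<lambda>x. x) \<in> linear_maps K V V"
  unfolding linear_maps_def by auto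

lemma linear_maps_inv_into:
  assumes V: "Module.module K V" and f: "f \<in> linear_maps K V W"
    and bij: "bij_betw f (carrier V) (carrier W)"
  shows "inv_into (carrier V) f \<in> linear_maps K W V"
proof -
  interpret V: Module.module K V by (rule V)
  let ?g = "inv_into (carrier V) f"
  have fg: "y \<in> carrier W \<Longrightarrow> f (?g y) = y" for y
    using bij by (simp add: bij_betw_inv_into_right)
  have gf: "x \<in> carrier V \<Longrightarrow> ?g (f x) = x" for x
    using bij by (simp add: bij_betw_inv_into_left)
  have gV: "y \<in> carrier W \<Longrightarrow> ?g y \<in> carrier V" for y
    using bij bij_betw_apply bij_betw_inv_into by metis
  show ?thesis unfolding linear_maps_def
  proof (intro CollectI conjI ballI)
    show "?g \<in> carrier W \<rightarrow> carrier V" using gV by auto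
  next
    fix x y assume xy: "x \<in> carrier W" "y \<in> carrier W"
    have "f (?g x \<oplus>\<^bsub>V\<^esub> ?g y) = x \<oplus>\<^bsub>W\<^esub> y"
      using xy by (simp add: linear_mapsD(2)[OF f] gV fg)
    then show "?g (x \<oplus>\<^bsub>W\<^esub> y) = ?g x \<oplus>\<^bsub>V\<^esub> ?g y"
      using gf[of "?g x \<oplus>\<^bsub>V\<^esub> ?g y"] xy gV by simp
  next
    fix c x assume cx: "c \<in> carrier K" "x \<in> carrier W"
    have "f (c \<odot>\<^bsub>V\<^esub> ?g x) = c \<odot>\<^bsub>W\<^esub> x"
      using cx by (simp add: linear_mapsD(3)[OF f] gV fg)
    then show "?g (c \<odot>\<^bsub>W\<^esub> x) = c \<odot>\<^bsub>V\<^esub> ?g x"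
      using gf[of "c \<odot>\<^bsub>V\<^esub> ?g x"] cx gV by simp
  qed
qed

lemma pmod_iso_refl: "pmod_iso K M M"
  unfolding pmod_iso_def
  by (rule exI[of _ "\<lambda>a x. x"]) (simp add: linear_maps_id bij_betw_def inj_on_def)

text \<open>
  A morphism from \<open>M\<close> to the translate of \<open>N\<close> by \<open>\<epsilon>\<close>; an interleaving consists of two of
  them. Isomorphisms are the bijective ones with \<open>\<epsilon> = 0\<close>, so both notions share the lemmas below.
\<close>
definition shift_morphism ::
    "('k, 'm) ring_scheme \<Rightarrow> real \<Rightarrow> ('k, 'v) pmod \<Rightarrow> ('k, 'w) pmod \<Rightarrow> (real \<Rightarrow> 'v \<Rightarrow> 'w) \<Rightarrow> bool" where
  "shift_morphism K \<epsilon> M N f \<longleftrightarrow>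
     (\<forall>a. f a \<in> linear_maps K (fib M a) (fib N (a + \<epsilon>))) \<and>
     (\<forall>a b. a \<le> b \<longrightarrow> (\<forall>x\<in>carrier (fib M a).
        f b (tr M a b x) = tr N (a + \<epsilon>) (b + \<epsilon>) (f a x)))"

lemma shift_morphismD:
  assumes "shift_morphism K \<epsilon> M N f"
  shows "f a \<in> linear_maps K (fib M a) (fib N (a + \<epsilon>))"
    and "\<lbrakk>a \<le> b; x \<in> carrier (fib M a)\<rbrakk> \<Longrightarrow> f b (tr M a b x) = tr N (a + \<epsilon>) (b + \<epsilon>) (f a x)"
    and "x \<in> carrier (fib M a) \<Longrightarrow> f a x \<in> carrier (fib N (a + \<epsilon>))"
  using assms unfolding shift_morphism_def linear_maps_def by blast+

lemma shift_morphism_compose: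
  assumes f: "shift_morphism K \<epsilon> M N f" and g: "shift_morphism K \<delta> N P g"
  shows "shift_morphism K (\<epsilon> + \<delta>) M P (\<lambda>a x. g (a + \<epsilon>) (f a x))"
  unfolding shift_morphism_def
proof (intro conjI allI impI ballI)
  fix a
  show "(\<lambda>x. g (a + \<epsilon>) (f a x)) \<in> linear_maps K (fib M a) (fib P (a + (\<epsilon> + \<delta>)))"
    using linear_maps_compose[OF shift_morphismD(1)[OF f] shift_morphismD(1)[OF g]]
    by (simp add: add.assoc)
next
  fix a b x assume "a \<le> b" "x \<in> carrier (fib M a)"
  then show "g (b + \<epsilon>) (f b (tr M a b x)) = tr P (a + (\<epsilon> + \<delta>)) (b + (\<epsilon> + \<delta>)) (g (a + \<epsilon>) (f a x))"
    using shift_morphismD(2)[OF g, of "a + \<epsilon>" "b + \<epsilon>"] shift_morphismD(2,3)[OF f]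
    by (simp add: add.assoc)
qed

lemma pmod_iso_iff_bijective_shift_morphism:
  "pmod_iso K M N \<longleftrightarrow> (\<exists>f. shift_morphism K 0 M N f \<and>
     (\<forall>a. bij_betw (f a) (carrier (fib M a)) (carrier (fib N a))))"
  unfolding pmod_iso_def shift_morphism_def by (simp only: add_0_right) blast

lemma pmod_iso_trans:
  assumes "pmod_iso K M N" "pmod_iso K N P"
  shows "pmod_iso K M P"
proof -
  obtain f where f: "shift_morphism K 0 M N f"
    "\<And>a. bij_betw (f a) (carrier (fib M a)) (carrier (fib N a))"
    using assms(1) unfolding pmod_iso_iff_bijective_shift_morphism by blast
  obtain g where g: "shift_morphism K 0 N P g"
    "\<And>a. bij_betw (g a) (carrier (fib N a)) (carrier (fib P a))"
    using assms(2) unfolding pmod_iso_iff_bijective_shift_morphism by blast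
  have "shift_morphism K 0 M P (\<lambda>a x. g a (f a x))"
    using shift_morphism_compose[OF f(1) g(1)] by simp
  moreover have "bij_betw (\<lambda>x. g a (f a x)) (carrier (fib M a)) (carrier (fib P a))" for a
    using bij_betw_trans[OF f(2) g(2), of a] by (simp add: comp_def)
  ultimately show ?thesis unfolding pmod_iso_iff_bijective_shift_morphism by blast
qed

lemma pmod_iso_inverse:
  assumes M: "persistence_module K M" and "pmod_iso K M N"
  obtains f g where "shift_morphism K 0 M N f" "shift_morphism K 0 N M g"
    "\<And>a x. x \<in> carrier (fib M a) \<Longrightarrow> g a (f a x) = x"
    "\<And>a y. y \<in> carrier (fib N a) \<Longrightarrow> f a (g a y) = y"
proof -
  interpret M: persistence_module K M by (rule M)
  obtain f where f: "shift_morphism K 0 M N f"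
    and bij: "\<And>a. bij_betw (f a) (carrier (fib M a)) (carrier (fib N a))"
    using assms(2) unfolding pmod_iso_iff_bijective_shift_morphism by blast
  define g where "g a = inv_into (carrier (fib M a)) (f a)" for a
  have gf: "g a (f a x) = x" if "x \<in> carrier (fib M a)" for a x
    using bij_betw_inv_into_left[OF bij that] by (simp add: g_def)
  have fg: "f a (g a y) = y" if "y \<in> carrier (fib N a)" for a y
    using bij_betw_inv_into_right[OF bij that] by (simp add: g_def)
  have g: "g a \<in> linear_maps K (fib N a) (fib M a)" for a
    using linear_maps_inv_into[OF M.fib_vector_space _ bij] shift_morphismD(1)[OF f]
    by (simp add: g_def)
  have "g b (tr N a b y) = tr M a b (g a y)" if ab: "a \<le> b" and y: "y \<in> carrier (fib N a)" for a b y
  proof -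
    have gy: "g a y \<in> carrier (fib M a)" by (rule linear_mapsD(1)[OF g y])
    have "tr N a b y = f b (tr M a b (g a y))"
      using shift_morphismD(2)[OF f ab gy] fg[OF y] by simp
    then show ?thesis
      using gf[OF linear_mapsD(1)[OF M.tr_linear[OF ab] gy]] by simp
  qed
  with g have "shift_morphism K 0 N M g" by (simp add: shift_morphism_def)
  then show thesis using that f gf fg by blast
qed

lemma pmod_iso_sym:
  assumes M: "persistence_module K M" and iso: "pmod_iso K M N"
  shows "pmod_iso K N M"
proof -
  obtain f g where f: "shift_morphism K 0 M N f" and g: "shift_morphism K 0 N M g"
    and gf: "\<And>a x. x \<in> carrier (fib M a) \<Longrightarrow> g a (f a x) = x"
    and fg: "\<And>a y. y \<in> carrier (fib N a) \<Longrightarrow> f a (g a y) = y"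
    using pmod_iso_inverse[OF M iso] by metis
  have "bij_betw (g a) (carrier (fib N a)) (carrier (fib M a))" for a
    using shift_morphismD(3)[OF f] shift_morphismD(3)[OF g]
    by (intro bij_betw_byWitness[where f' = "f a"]) (auto simp: gf fg)
  with g show ?thesis unfolding pmod_iso_iff_bijective_shift_morphism by blast
qed

lemma iso_class_self: "persistence_module K M \<Longrightarrow> M \<in> iso_class K M"
  unfolding iso_class_def by (simp add: pmod_iso_refl)

lemma iso_class_eqI:
  assumes "persistence_module K M" "pmod_iso K M N"
  shows "iso_class K M = iso_class K N"
  using pmod_iso_sym[OF assms] pmod_iso_trans assms(2) unfolding iso_class_def by blast

section \<open>Interleavings and the distance of isomorphism classes\<close>

text \<open>
  One of the two triangle identities of an interleaving. Treating it separately lets every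
  statement about interleavings be proved for one direction and then used for both.
\<close>
definition factors_double_shift ::
    "real \<Rightarrow> ('k, 'v) pmod \<Rightarrow> (real \<Rightarrow> 'v \<Rightarrow> 'w) \<Rightarrow> (real \<Rightarrow> 'w \<Rightarrow> 'v) \<Rightarrow> bool" where
  "factors_double_shift \<epsilon> M f g \<longleftrightarrow>
     (\<forall>a. \<forall>x\<in>carrier (fib M a). g (a + \<epsilon>) (f a x) = tr M a (a + 2 * \<epsilon>) x)"

lemma interleaved_iff:
  "interleaved K \<epsilon> M N \<longleftrightarrow> (\<exists>f g. shift_morphism K \<epsilon> M N f \<and> shift_morphism K \<epsilon> N M g \<and>
     factors_double_shift \<epsilon> M f g \<and> factors_double_shift \<epsilon> N g f)"
  unfolding interleaved_def shift_morphism_def factors_double_shift_def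
  by (intro ex_cong1) auto

lemma interleaved_sym: "interleaved K \<epsilon> M N \<Longrightarrow> interleaved K \<epsilon> N M"
  unfolding interleaved_iff by blast

text \<open>
  The inner round trip by \<open>f'\<close> and \<open>g'\<close> is a structure map of \<open>N\<close>; naturality of \<open>g\<close> moves it past \<open>g\<close>
  to become a structure map of \<open>M\<close>, where it composes with the outer round trip.
\<close>
lemma factors_double_shift_compose:
  assumes M: "persistence_module K M" and \<epsilon>: "0 \<le> \<epsilon>" and \<delta>: "0 \<le> \<delta>"
    and f: "shift_morphism K \<epsilon> M N f" and g: "shift_morphism K \<epsilon> N M g"
    and gf: "factors_double_shift \<epsilon> M f g" and gf': "factors_double_shift \<delta> N f' g'"
  shows "factors_double_shift (\<epsilon> + \<delta>) M (\<lambda>a x. f' (a + \<epsilon>) (f a x)) (\<lambda>a x. g (a + \<delta>) (g' a x))"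
  unfolding factors_double_shift_def
proof (intro allI ballI)
  fix a x assume x: "x \<in> carrier (fib M a)"
  have fx: "f a x \<in> carrier (fib N (a + \<epsilon>))" by (rule shift_morphismD(3)[OF f x])
  have "g (a + (\<epsilon> + \<delta>) + \<delta>) (g' (a + (\<epsilon> + \<delta>)) (f' (a + \<epsilon>) (f a x)))
      = g (a + \<epsilon> + 2 * \<delta>) (g' (a + \<epsilon> + \<delta>) (f' (a + \<epsilon>) (f a x)))"
    by (simp add: algebra_simps)
  also have "\<dots> = g (a + \<epsilon> + 2 * \<delta>) (tr N (a + \<epsilon>) (a + \<epsilon> + 2 * \<delta>) (f a x))"
    using gf' fx by (simp add: factors_double_shift_def)
  also have "\<dots> = tr M (a + \<epsilon> + \<epsilon>) (a + \<epsilon> + 2 * \<delta> + \<epsilon>) (g (a + \<epsilon>) (f a x))"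
    using \<delta> by (intro shift_morphismD(2)[OF g] fx) simp
  also have "\<dots> = tr M (a + 2 * \<epsilon>) (a + 2 * (\<epsilon> + \<delta>)) (tr M a (a + 2 * \<epsilon>) x)"
    using gf x by (simp only: factors_double_shift_def) (simp add: algebra_simps)
  also have "\<dots> = tr M a (a + 2 * (\<epsilon> + \<delta>)) x"
    using \<epsilon> \<delta> by (intro persistence_module.tr_comp[OF M] x) auto
  finally show "g (a + (\<epsilon> + \<delta>) + \<delta>) (g' (a + (\<epsilon> + \<delta>)) (f' (a + \<epsilon>) (f a x)))
      = tr M a (a + 2 * (\<epsilon> + \<delta>)) x" .
qed

lemma interleaved_trans:
  assumes M: "persistence_module K M" and P: "persistence_module K P"
    and \<epsilon>: "0 \<le> \<epsilon>" and \<delta>: "0 \<le> \<delta>"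
    and MN: "interleaved K \<epsilon> M N" and NP: "interleaved K \<delta> N P"
  shows "interleaved K (\<epsilon> + \<delta>) M P"
proof -
  obtain f g where f: "shift_morphism K \<epsilon> M N f" and g: "shift_morphism K \<epsilon> N M g"
    and gf: "factors_double_shift \<epsilon> M f g" and fg: "factors_double_shift \<epsilon> N g f"
    using MN unfolding interleaved_iff by blast
  obtain f' g' where f': "shift_morphism K \<delta> N P f'" and g': "shift_morphism K \<delta> P N g'"
    and gf': "factors_double_shift \<delta> N f' g'" and fg': "factors_double_shift \<delta> P g' f'"
    using NP unfolding interleaved_iff by blast
  have "shift_morphism K (\<epsilon> + \<delta>) P M (\<lambda>a x. g (a + \<delta>) (g' a x))"
    and "factors_double_shift (\<epsilon> + \<delta>) P (\<lambda>a x. g (a + \<delta>) (g' a x)) (\<lambda>a x. f' (a + \<epsilon>) (f a x))"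
    using shift_morphism_compose[OF g' g] factors_double_shift_compose[OF P \<delta> \<epsilon> g' f' fg' fg]
    by (simp_all add: add.commute)
  then show ?thesis
    unfolding interleaved_iff
    using shift_morphism_compose[OF f f'] factors_double_shift_compose[OF M \<epsilon> \<delta> f g gf gf']
    by blast
qed

lemma interleaved_0_if_pmod_iso:
  assumes M: "persistence_module K M" and N: "persistence_module K N" and iso: "pmod_iso K M N"
  shows "interleaved K 0 M N"
proof -
  obtain f g where "shift_morphism K 0 M N f" "shift_morphism K 0 N M g"
    and "\<And>a x. x \<in> carrier (fib M a) \<Longrightarrow> g a (f a x) = x"
    and "\<And>a y. y \<in> carrier (fib N a) \<Longrightarrow> f a (g a y) = y"
    using pmod_iso_inverse[OF M iso] by metis
  moreover from this have "factors_double_shift 0 M f g" "factors_double_shift 0 N g f"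
    using persistence_module.tr_refl[OF M] persistence_module.tr_refl[OF N]
    by (simp_all add: factors_double_shift_def)
  ultimately show ?thesis unfolding interleaved_iff by blast
qed

text \<open>
  An isomorphism is a \<open>0\<close>-interleaving, and composing with one leaves \<open>\<epsilon>\<close> unchanged.
\<close>
lemma interleaved_cong_iso:
  assumes M: "persistence_module K M" and N: "persistence_module K N"
    and M': "M' \<in> iso_class K M" and N': "N' \<in> iso_class K N"
    and \<epsilon>: "0 \<le> \<epsilon>"
  shows "interleaved K \<epsilon> M' N' \<longleftrightarrow> interleaved K \<epsilon> M N"
proof -
  have pm: "persistence_module K M'" "persistence_module K N'"
    using M' N' by (auto simp: iso_class_def)
  have i: "interleaved K 0 M M'" "interleaved K 0 N N'"
    using M' N' M N by (auto simp: iso_class_def intro: interleaved_0_if_pmod_iso)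
  have "interleaved K (0 + (\<epsilon> + 0)) M N" if "interleaved K \<epsilon> M' N'"
    using interleaved_trans[OF M N _ _ i(1) interleaved_trans[OF pm(1) N \<epsilon> _ that interleaved_sym[OF i(2)]]] \<epsilon>
    by simp
  moreover have "interleaved K (0 + (\<epsilon> + 0)) M' N'" if "interleaved K \<epsilon> M N"
    using interleaved_trans[OF pm _ _ interleaved_sym[OF i(1)] interleaved_trans[OF M pm(2) \<epsilon> _ that i(2)]] \<epsilon>
    by simp
  ultimately show ?thesis by auto
qed

text \<open>
  The link between the distance of classes and interleavings of representatives. The set whose
  only element defines \<open>class_dist\<close> is a singleton because classes are nonempty and interleavings
  transfer along isomorphisms.
\<close>
lemma class_dist_less_iff:
  assumes M: "persistence_module K M" and N: "persistence_module K N"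
  shows "class_dist K (iso_class K M) (iso_class K N) < ereal r
    \<longleftrightarrow> (\<exists>\<epsilon>\<ge>0. \<epsilon> < r \<and> interleaved K \<epsilon> M N)"
proof -
  have "interleaving_dist K M' N' = interleaving_dist K M N"
    if "M' \<in> iso_class K M" "N' \<in> iso_class K N" for M' N'
    unfolding interleaving_dist_def using interleaved_cong_iso[OF M N that]
    by (intro INF_cong) auto
  then have "(\<lambda>(M, N). interleaving_dist K M N) ` (iso_class K M \<times> iso_class K N)
      = (\<lambda>_. interleaving_dist K M N) ` (iso_class K M \<times> iso_class K N)"
    by (intro image_cong) (simp_all add: case_prod_beta mem_Times_iff)
  also have "\<dots> = {interleaving_dist K M N}"
    using iso_class_self[OF M] iso_class_self[OF N] by (intro image_constant) blast
  finally have "class_dist K (iso_class K M) (iso_class K N) = interleaving_dist K M N"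
    by (simp add: class_dist_def)
  then show ?thesis by (auto simp: interleaving_dist_def INF_less_iff)
qed

lemma extended_pseudometric_class_dist:
  assumes S: "\<And>A. A \<in> S \<Longrightarrow> \<exists>M. persistence_module K M \<and> A = iso_class K M"
  shows "extended_pseudometric S (class_dist K)"
proof
  fix A and r :: real
  assume "A \<in> S" and r: "0 < r"
  then obtain M where M: "persistence_module K M" "A = iso_class K M" using S by blast
  have "interleaved K 0 M M"
    by (rule interleaved_0_if_pmod_iso[OF M(1) M(1) pmod_iso_refl])
  then show "class_dist K A A < ereal r"
    unfolding M(2) class_dist_less_iff[OF M(1) M(1)] using r by blast
next
  fix A B and r :: real
  assume "A \<in> S" "B \<in> S" and AB: "class_dist K A B < ereal r"
  then obtain M N where M: "persistence_module K M" "A = iso_class K M"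
    and N: "persistence_module K N" "B = iso_class K N" using S by metis
  show "class_dist K B A < ereal r"
    using AB interleaved_sym
    unfolding M(2) N(2) class_dist_less_iff[OF M(1) N(1)] class_dist_less_iff[OF N(1) M(1)]
    by blast
next
  fix A B C and r s :: real
  assume "A \<in> S" "B \<in> S" "C \<in> S"
    and AB: "class_dist K A B < ereal r" and BC: "class_dist K B C < ereal s"
  then obtain M N P where M: "persistence_module K M" "A = iso_class K M"
    and N: "persistence_module K N" "B = iso_class K N"
    and P: "persistence_module K P" "C = iso_class K P" using S by metis
  obtain \<epsilon> where \<epsilon>: "0 \<le> \<epsilon>" "\<epsilon> < r" "interleaved K \<epsilon> M N"
    using AB unfolding M(2) N(2) class_dist_less_iff[OF M(1) N(1)] by blast
  obtain \<delta> where \<delta>: "0 \<le> \<delta>" "\<delta> < s" "interleaved K \<delta> N P"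
    using BC unfolding N(2) P(2) class_dist_less_iff[OF N(1) P(1)] by blast
  have "interleaved K (\<epsilon> + \<delta>) M P"
    by (rule interleaved_trans[OF M(1) P(1) \<epsilon>(1) \<delta>(1) \<epsilon>(3) \<delta>(3)])
  then show "class_dist K A C < ereal (r + s)"
    unfolding M(2) P(2) class_dist_less_iff[OF M(1) P(1)]
    using \<epsilon> \<delta> by (intro exI[of _ "\<epsilon> + \<delta>"]) auto
qed

section \<open>Interval modules and their direct sums\<close>

lemma trivial_space_module:
  assumes "Ring.field K" shows "Module.module K (trivial_space z)"
proof -
  interpret K: Ring.field K by (rule assms)
  show ?thesis
    by (intro moduleI abelian_groupI K.is_cring) (auto simp: trivial_space_def)
qed

lemma interval_module_persistence:
  assumes K: "Ring.field K" and J: "is_interval J"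
  shows "persistence_module K (interval_module K J)"
proof -
  interpret K: Ring.field K by (rule K)
  have "Module.module K (fib (interval_module K J) a)" for a
  proof (cases "a \<in> J")
    case True
    then show ?thesis
      by (intro moduleI abelian_groupI K.is_cring)
        (auto simp: interval_module_def K.l_distr K.r_distr K.m_assoc K.a_ac
          intro: K.l_neg bexI[of _ "\<ominus>\<^bsub>K\<^esub> _"])
  next
    case False
    then show ?thesis using trivial_space_module[OF K] by (simp add: interval_module_def)
  qed
  moreover have "tr (interval_module K J) a b \<in>
      linear_maps K (fib (interval_module K J) a) (fib (interval_module K J) b)" for a b
    by (auto simp: linear_maps_def interval_module_def trivial_space_def)
  moreover have "tr (interval_module K J) b c (tr (interval_module K J) a b x) = tr (interval_module K J) a c x"
    if "a \<le> b" "b \<le> c" for a b c x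
    using mem_is_interval_1_I[OF J _ _ that] by (auto simp: interval_module_def)
  moreover have "tr (interval_module K J) a a x = x"
    if "x \<in> carrier (fib (interval_module K J) a)" for a x
    using that by (auto simp: interval_module_def trivial_space_def split: if_splits)
  ultimately show ?thesis by (intro persistence_module.intro persistence_module_axioms.intro K)
qed

lemma linear_maps_product:
  assumes "\<And>i. i \<in> I \<Longrightarrow> f i \<in> linear_maps K (fib (M i) a) (fib (N i) b)"
  shows "(\<lambda>x. \<lambda>i\<in>I. f i (x i))
    \<in> linear_maps K (fib (finite_direct_sum I M) a) (fib (finite_direct_sum I N) b)"
  using linear_mapsD[OF assms]
  by (auto simp: linear_maps_def finite_direct_sum_def PiE_iff intro!: restrict_ext)

lemma finite_direct_sum_persistence:
  assumes K: "Ring.field K" and M: "\<And>i. i \<in> I \<Longrightarrow> persistence_module K (M i)"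
  shows "persistence_module K (finite_direct_sum I M)"
proof -
  interpret K: Ring.field K by (rule K)
  have "Module.module K (fib (finite_direct_sum I M) a)" for a
  proof -
    let ?S = "fib (finite_direct_sum I M) a"
    have m: "Module.module K (fib (M i) a)" if "i \<in> I" for i
      using M[OF that] by (rule persistence_module.fib_vector_space)
    note ag = module.axioms(2)[OF m]
    note am = abelian_group.axioms(1)[OF ag]
    have "abelian_group ?S"
    proof (rule abelian_groupI)
      fix x assume x: "x \<in> carrier ?S"
      let ?y = "\<lambda>i\<in>I. \<ominus>\<^bsub>fib (M i) a\<^esub> x i"
      have "?y \<in> carrier ?S" "?y \<oplus>\<^bsub>?S\<^esub> x = \<zero>\<^bsub>?S\<^esub>"
        using x by (auto simp: finite_direct_sum_def PiE_iff abelian_group.a_inv_closed[OF ag]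
            abelian_group.l_neg[OF ag] intro!: restrict_ext)
      then show "\<exists>y\<in>carrier ?S. y \<oplus>\<^bsub>?S\<^esub> x = \<zero>\<^bsub>?S\<^esub>" by blast
    next
      fix x assume "x \<in> carrier ?S"
      then show "\<zero>\<^bsub>?S\<^esub> \<oplus>\<^bsub>?S\<^esub> x = x"
        by (auto simp: finite_direct_sum_def PiE_iff abelian_monoid.l_zero[OF am] extensional_def
            intro!: ext)
    qed (auto simp: finite_direct_sum_def PiE_iff abelian_monoid.a_closed[OF am]
          abelian_monoid.zero_closed[OF am] abelian_monoid.a_assoc[OF am]
          intro!: restrict_ext abelian_monoid.a_comm[OF am])
    then show ?thesis
    proof (intro moduleI K.is_cring)
      fix x assume "x \<in> carrier ?S"
      then show "\<one>\<^bsub>K\<^esub> \<odot>\<^bsub>?S\<^esub> x = x"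
        by (auto simp: finite_direct_sum_def PiE_iff module.smult_one[OF m] extensional_def
            intro!: ext)
    qed (auto simp: finite_direct_sum_def PiE_iff module.smult_closed[OF m]
        intro!: restrict_ext module.smult_l_distr[OF m] module.smult_r_distr[OF m]
          module.smult_assoc1[OF m])
  qed
  moreover have "tr (finite_direct_sum I M) a b
      \<in> linear_maps K (fib (finite_direct_sum I M) a) (fib (finite_direct_sum I M) b)"
    if "a \<le> b" for a b
    using linear_maps_product[OF persistence_module.tr_linear[OF M that]]
    by (simp add: finite_direct_sum_def)
  moreover have "tr (finite_direct_sum I M) a a x = x"
    if "x \<in> carrier (fib (finite_direct_sum I M) a)" for a x
  proof -
    have x: "x \<in> extensional I" "\<And>i. i \<in> I \<Longrightarrow> x i \<in> carrier (fib (M i) a)"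
      using that by (auto simp: finite_direct_sum_def PiE_iff)
    have "(\<lambda>i\<in>I. tr (M i) a a (x i)) = restrict x I"
      using persistence_module.tr_refl[OF M x(2)] by (intro restrict_ext)
    then show ?thesis using x(1) by (simp add: finite_direct_sum_def extensional_restrict)
  qed
  moreover have "tr (finite_direct_sum I M) b c (tr (finite_direct_sum I M) a b x)
      = tr (finite_direct_sum I M) a c x"
    if "a \<le> b" "b \<le> c" "x \<in> carrier (fib (finite_direct_sum I M) a)" for a b c x
  proof -
    have x: "\<And>i. i \<in> I \<Longrightarrow> x i \<in> carrier (fib (M i) a)"
      using that(3) by (auto simp: finite_direct_sum_def PiE_iff)
    have "(\<lambda>i\<in>I. tr (M i) b c (tr (M i) a b (x i))) = (\<lambda>i\<in>I. tr (M i) a c (x i))"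
      using persistence_module.tr_comp[OF M that(1,2) x] by (intro restrict_ext)
    then show ?thesis by (simp add: finite_direct_sum_def cong: restrict_cong)
  qed
  ultimately show ?thesis by (intro persistence_module.intro persistence_module_axioms.intro K)
qed

lemma interval_sum_persistence:
  assumes "Ring.field K" "\<And>i. i \<in> I \<Longrightarrow> is_interval (J i)"
  shows "persistence_module K (finite_direct_sum I (\<lambda>i. interval_module K (J i)))"
  by (intro finite_direct_sum_persistence interval_module_persistence assms)

lemma interleaved_direct_sum:
  assumes "\<And>i. i \<in> I \<Longrightarrow> interleaved K \<epsilon> (M i) (N i)"
  shows "interleaved K \<epsilon> (finite_direct_sum I M) (finite_direct_sum I N)"
proof -
  have sum_morphism: "shift_morphism K \<epsilon> (finite_direct_sum I M) (finite_direct_sum I N)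
      (\<lambda>a x. \<lambda>i\<in>I. f i a (x i))"
    if "\<And>i. i \<in> I \<Longrightarrow> shift_morphism K \<epsilon> (M i) (N i) (f i)" for M N f
    unfolding shift_morphism_def
  proof (intro conjI allI impI ballI)
    fix a
    show "(\<lambda>x. \<lambda>i\<in>I. f i a (x i))
        \<in> linear_maps K (fib (finite_direct_sum I M) a) (fib (finite_direct_sum I N) (a + \<epsilon>))"
      by (rule linear_maps_product) (rule shift_morphismD(1)[OF that])
  qed (auto simp: finite_direct_sum_def PiE_iff shift_morphismD(2)[OF that] intro!: restrict_ext)
  have sum_factors: "factors_double_shift \<epsilon> (finite_direct_sum I M)
      (\<lambda>a x. \<lambda>i\<in>I. f i a (x i)) (\<lambda>a x. \<lambda>i\<in>I. g i a (x i))"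
    if "\<And>i. i \<in> I \<Longrightarrow> factors_double_shift \<epsilon> (M i) (f i) (g i)" for M f g
    using that by (auto simp: factors_double_shift_def finite_direct_sum_def PiE_iff intro!: restrict_ext)
  have "\<forall>i\<in>I. \<exists>f g. shift_morphism K \<epsilon> (M i) (N i) f \<and> shift_morphism K \<epsilon> (N i) (M i) g \<and>
      factors_double_shift \<epsilon> (M i) f g \<and> factors_double_shift \<epsilon> (N i) g f"
    using assms unfolding interleaved_iff by blast
  then obtain f g where "\<And>i. i \<in> I \<Longrightarrow> shift_morphism K \<epsilon> (M i) (N i) (f i)"
    "\<And>i. i \<in> I \<Longrightarrow> shift_morphism K \<epsilon> (N i) (M i) (g i)"
    "\<And>i. i \<in> I \<Longrightarrow> factors_double_shift \<epsilon> (M i) (f i) (g i)"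
    "\<And>i. i \<in> I \<Longrightarrow> factors_double_shift \<epsilon> (N i) (g i) (f i)"
    by metis
  then show ?thesis
    unfolding interleaved_iff
    using sum_morphism[of M N f] sum_morphism[of N M g] sum_factors[of M f g] sum_factors[of N g f]
    by blast
qed

definition interval_shift_map ::
    "('k, 'm) ring_scheme \<Rightarrow> real \<Rightarrow> real set \<Rightarrow> real set \<Rightarrow> real \<Rightarrow> 'k \<Rightarrow> 'k" where
  "interval_shift_map K \<epsilon> I J a x = (if a \<in> I \<and> a + \<epsilon> \<in> J then x else \<zero>\<^bsub>K\<^esub>)"

text \<open>
  The conditions on \<open>I\<close> and \<open>J\<close> under which \<open>interval_shift_map\<close> is natural (first line) and has
  the right composite with the map in the opposite direction (second line). For nonempty
  intervals the first line says that neither end of \<open>J\<close>, moved left by \<open>\<epsilon>\<close>, lies to the right of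
  the corresponding end of \<open>I\<close>. The second line also makes sense for empty \<open>J\<close>, where it says that no two points
  of \<open>I\<close> are at distance \<open>2 \<epsilon>\<close>; this is how a short interval is compared with zero.
\<close>
definition shift_compatible :: "real \<Rightarrow> real set \<Rightarrow> real set \<Rightarrow> bool" where
  "shift_compatible \<epsilon> I J \<longleftrightarrow>
     (\<forall>a\<in>I. \<forall>b\<ge>a. b + \<epsilon> \<in> J \<longrightarrow> a + \<epsilon> \<in> J \<and> b \<in> I) \<and>
     (\<forall>a\<in>I. a + 2 * \<epsilon> \<in> I \<longrightarrow> a + \<epsilon> \<in> J)"

lemma interval_shift_map_shift_morphism:
  assumes K: "Ring.field K" and IJ: "shift_compatible \<epsilon> I J"
  shows "shift_morphism K \<epsilon> (interval_module K I) (interval_module K J) (interval_shift_map K \<epsilon> I J)"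
proof -
  interpret K: Ring.field K by (rule K)
  have "interval_shift_map K \<epsilon> I J a
      \<in> linear_maps K (fib (interval_module K I) a) (fib (interval_module K J) (a + \<epsilon>))" for a
    by (auto simp: linear_maps_def interval_shift_map_def interval_module_def trivial_space_def)
  moreover have "interval_shift_map K \<epsilon> I J b (tr (interval_module K I) a b x)
      = tr (interval_module K J) (a + \<epsilon>) (b + \<epsilon>) (interval_shift_map K \<epsilon> I J a x)"
    if "a \<le> b" for a b x
  proof -
    have "a \<in> I \<and> b \<in> I \<and> b + \<epsilon> \<in> J \<longleftrightarrow> a \<in> I \<and> a + \<epsilon> \<in> J \<and> b + \<epsilon> \<in> J"
      using IJ that unfolding shift_compatible_def by blast
    then show ?thesis by (simp add: interval_shift_map_def interval_module_def) metis
  qed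
  ultimately show ?thesis by (simp add: shift_morphism_def)
qed

lemma interval_shift_map_factors_double_shift:
  assumes "shift_compatible \<epsilon> I J"
  shows "factors_double_shift \<epsilon> (interval_module K I)
    (interval_shift_map K \<epsilon> I J) (interval_shift_map K \<epsilon> J I)"
  unfolding factors_double_shift_def
proof (intro allI ballI)
  fix a x
  have mid: "a + \<epsilon> \<in> J" if "a \<in> I" "a + 2 * \<epsilon> \<in> I"
    using assms that unfolding shift_compatible_def by blast
  have shift2: "a + \<epsilon> + \<epsilon> = a + 2 * \<epsilon>" by simp
  show "interval_shift_map K \<epsilon> J I (a + \<epsilon>) (interval_shift_map K \<epsilon> I J a x)
      = tr (interval_module K I) a (a + 2 * \<epsilon>) x"
    by (auto simp: interval_shift_map_def interval_module_def shift2 dest: mid)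
qed

lemma interleaved_interval_modules:
  assumes "Ring.field K" "shift_compatible \<epsilon> I J" "shift_compatible \<epsilon> J I"
  shows "interleaved K \<epsilon> (interval_module K I) (interval_module K J)"
  unfolding interleaved_iff
  using interval_shift_map_shift_morphism interval_shift_map_factors_double_shift assms by metis

lemma carrier_interval_sum_outside:
  assumes "\<And>i. i \<in> I \<Longrightarrow> a \<notin> J i"
  shows "carrier (fib (finite_direct_sum I (\<lambda>i. interval_module K (J i))) a) = {\<lambda>i\<in>I. \<zero>\<^bsub>K\<^esub>}"
proof -
  have "carrier (fib (interval_module K (J i)) a) = {\<zero>\<^bsub>K\<^esub>}" if "i \<in> I" for i
    using assms[OF that] by (simp add: interval_module_def trivial_space_def)
  then have "carrier (fib (finite_direct_sum I (\<lambda>i. interval_module K (J i))) a) = (\<Pi>\<^sub>E i\<in>I. {\<zero>\<^bsub>K\<^esub>})"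
    by (simp add: finite_direct_sum_def cong: PiE_cong)
  then show ?thesis by (simp add: PiE_singleton)
qed

lemma sum_of_empty_intervals_iso_zero:
  assumes "\<And>i. i \<in> I \<Longrightarrow> J i = {}"
  shows "pmod_iso K (finite_direct_sum I (\<lambda>i. interval_module K (J i))) zero_pmod"
proof -
  let ?M = "finite_direct_sum I (\<lambda>i. interval_module K (J i))"
  have c: "carrier (fib ?M a) = {\<lambda>i\<in>I. \<zero>\<^bsub>K\<^esub>}" for a
    using assms by (intro carrier_interval_sum_outside) auto
  show ?thesis unfolding pmod_iso_def
    by (rule exI[of _ "\<lambda>_ _. undefined"])
      (auto simp: c linear_maps_def zero_pmod_def trivial_space_def bij_betw_def)
qed

section \<open>Shrinking bounded intervals\<close>

text \<open>
  At \<open>t = 0\<close> the image of \<open>J\<close> would be the point \<open>0\<close>, whose interval module is nonzero. The empty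
  set is taken instead, so that the sum of the shrunk intervals becomes the zero module.
\<close>
definition shrink :: "real \<Rightarrow> real set \<Rightarrow> real set" where
  "shrink t J = (if t = 0 then {} else (\<lambda>x. t * x) ` J)"

lemma shrink_1: "shrink 1 J = J"
  by (simp add: shrink_def)

lemma shrink_eq_empty_iff: "shrink t J = {} \<longleftrightarrow> t = 0 \<or> J = {}"
  by (simp add: shrink_def)

lemma is_interval_shrink:
  assumes "is_interval J" shows "is_interval (shrink t J)"
proof -
  have "convex J" using assms by (simp add: is_interval_convex_1)
  then have "convex ((\<lambda>x. t *\<^sub>R x) ` J)" by (rule convex_scaling)
  then show ?thesis by (simp add: shrink_def is_interval_convex_1)
qed

text \<open>
  Each point of \<open>J\<close> is scaled by \<open>t\<close> and by \<open>s\<close> to points less than \<open>\<epsilon>\<close> apart. The memberships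
  follow by squeezing a point between the images of two points \<open>j\<close> and \<open>j'\<close> of \<open>J\<close>. If \<open>s = 0\<close>, all
  points of \<open>t J\<close> have absolute value less than \<open>\<epsilon>\<close>, so no two of them are \<open>2 \<epsilon>\<close> apart.
\<close>
lemma shift_compatible_shrink:
  assumes J: "is_interval J" and R: "\<And>x. x \<in> J \<Longrightarrow> \<bar>x\<bar> \<le> R"
    and t: "0 \<le> t" and s: "0 \<le> s" and \<epsilon>: "\<bar>t - s\<bar> * R < \<epsilon>"
  shows "shift_compatible \<epsilon> (shrink t J) (shrink s J)"
proof -
  have close: "\<bar>t * j - s * j\<bar> < \<epsilon>" if "j \<in> J" for j
  proof -
    have "\<bar>t * j - s * j\<bar> = \<bar>t - s\<bar> * \<bar>j\<bar>" by (simp add: abs_mult flip: left_diff_distrib)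
    also have "\<dots> \<le> \<bar>t - s\<bar> * R" using R[OF that] by (intro mult_left_mono) auto
    finally show ?thesis using \<epsilon> by simp
  qed
  have between: "x \<in> shrink u J"
    if "u \<noteq> 0" "j \<in> J" "j' \<in> J" "u * j \<le> x" "x \<le> u * j'" for u x j j'
  proof -
    have "u * j \<in> shrink u J" "u * j' \<in> shrink u J" using that by (auto simp: shrink_def)
    then show ?thesis using mem_is_interval_1_I[OF is_interval_shrink[OF J]] that(4,5) by blast
  qed
  show ?thesis unfolding shift_compatible_def
  proof (intro conjI ballI allI impI)
    fix a b assume a: "a \<in> shrink t J" and ab: "a \<le> b" and b: "b + \<epsilon> \<in> shrink s J"
    obtain j where j: "t \<noteq> 0" "j \<in> J" "a = t * j" using a by (auto simp: shrink_def split: if_splits)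
    obtain j' where j': "s \<noteq> 0" "j' \<in> J" "b + \<epsilon> = s * j'" using b by (auto simp: shrink_def split: if_splits)
    show "a + \<epsilon> \<in> shrink s J"
      using close[OF j(2)] j(3) j'(3) ab by (intro between[OF j'(1) j(2) j'(2)]) auto
    show "b \<in> shrink t J"
      using close[OF j'(2)] j(3) j'(3) ab by (intro between[OF j(1,2) j'(2)]) auto
  next
    fix a assume a: "a \<in> shrink t J" "a + 2 * \<epsilon> \<in> shrink t J"
    obtain j where j: "t \<noteq> 0" "j \<in> J" "a = t * j" using a(1) by (auto simp: shrink_def split: if_splits)
    obtain j' where j': "j' \<in> J" "a + 2 * \<epsilon> = t * j'" using a(2) by (auto simp: shrink_def split: if_splits)
    show "a + \<epsilon> \<in> shrink s J"
    proof (cases "s = 0")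
      case True
      then show ?thesis using close[OF j(2)] close[OF j'(1)] j(3) j'(2) by auto
    next
      case False
      then show ?thesis
        using close[OF j(2)] close[OF j'(1)] j(3) j'(2) by (intro between[OF False j(2) j'(1)]) auto
    qed
  qed
qed

lemma interleaved_shrink_sum:
  assumes K: "Ring.field K" and J: "\<And>i. i \<in> I \<Longrightarrow> is_interval (J i)"
    and R: "\<And>i x. \<lbrakk>i \<in> I; x \<in> J i\<rbrakk> \<Longrightarrow> \<bar>x\<bar> \<le> R"
    and "0 \<le> t" "0 \<le> s" "\<bar>t - s\<bar> * R < \<epsilon>"
  shows "interleaved K \<epsilon> (finite_direct_sum I (\<lambda>i. interval_module K (shrink t (J i))))
    (finite_direct_sum I (\<lambda>i. interval_module K (shrink s (J i))))"
  using assms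
  by (intro interleaved_direct_sum interleaved_interval_modules shift_compatible_shrink)
    (auto simp: abs_minus_commute)

section \<open>Finite distance preserves boundedness\<close>

text \<open>
  Choose a point \<open>y\<close> of the interval much farther out than some point \<open>x\<close> in it; then the step of
  length \<open>2 \<epsilon>\<close> from \<open>y\<close> towards \<open>x\<close> stays in the interval and stays far out.
\<close>
lemma unbounded_interval_long_far_out:
  fixes J :: "real set"
  assumes J: "is_interval J" and unb: "\<not> bounded J" and \<epsilon>: "0 \<le> \<epsilon>"
  obtains a where "a \<in> J" "a + 2 * \<epsilon> \<in> J" "R < \<bar>a + \<epsilon>\<bar>"
proof -
  obtain x where x: "x \<in> J" using unb by fastforce
  obtain y where y: "y \<in> J" "\<bar>x\<bar> + \<bar>R\<bar> + 3 * \<epsilon> < \<bar>y\<bar>"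
    using unb unfolding bounded_iff by (metis not_le real_norm_def)
  show thesis
  proof (cases "x \<le> y")
    case True
    have "y - 2 * \<epsilon> \<in> J" using True y(2) \<epsilon> by (intro mem_is_interval_1_I[OF J x y(1)]) auto
    then show thesis using True y \<epsilon> by (intro that[of "y - 2 * \<epsilon>"]) auto
  next
    case False
    have "y + 2 * \<epsilon> \<in> J" using False y(2) \<epsilon> by (intro mem_is_interval_1_I[OF J y(1) x]) auto
    then show thesis using False y \<epsilon> by (intro that[of y]) auto
  qed
qed

text \<open>
  The fibre of the bounded sum at \<open>a + \<epsilon>\<close> has a single element, so the interleaving sends every two
  elements of the other fibre at \<open>a\<close> to the same place and the structure map over distance \<open>2 \<epsilon>\<close>
  cannot separate them. On an unbounded summand that map is the identity of the field and
  separates \<open>1\<close> from \<open>0\<close>.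
\<close>
lemma bounded_if_interleaved_with_bounded:
  assumes K: "Ring.field K" and J': "\<And>i. i \<in> I' \<Longrightarrow> is_interval (J' i)"
    and R: "\<And>i x. \<lbrakk>i \<in> I; x \<in> J i\<rbrakk> \<Longrightarrow> \<bar>x\<bar> \<le> R" and \<epsilon>: "0 \<le> \<epsilon>"
    and il: "interleaved K \<epsilon> (finite_direct_sum I (\<lambda>i. interval_module K (J i)))
      (finite_direct_sum I' (\<lambda>i. interval_module K (J' i)))"
    and i: "i \<in> I'"
  shows "bounded (J' i)"
proof (rule ccontr)
  assume "\<not> bounded (J' i)"
  then obtain a where a: "a \<in> J' i" "a + 2 * \<epsilon> \<in> J' i" "R < \<bar>a + \<epsilon>\<bar>"
    using unbounded_interval_long_far_out[OF J'[OF i] _ \<epsilon>] by blast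
  interpret K: Ring.field K by (rule K)
  let ?M = "finite_direct_sum I (\<lambda>i. interval_module K (J i))"
  let ?N = "finite_direct_sum I' (\<lambda>i. interval_module K (J' i))"
  obtain f g where g: "shift_morphism K \<epsilon> ?N ?M g" and gf: "factors_double_shift \<epsilon> ?N g f"
    using il unfolding interleaved_iff by blast
  have fg: "f (a + \<epsilon>) (g a y) = tr ?N a (a + 2 * \<epsilon>) y" if "y \<in> carrier (fib ?N a)" for y
    using gf that by (simp add: factors_double_shift_def)
  have "carrier (fib ?M (a + \<epsilon>)) = {\<lambda>i\<in>I. \<zero>\<^bsub>K\<^esub>}"
    using R a(3) by (intro carrier_interval_sum_outside) (meson not_le)
  then have M0: "x = y" if "x \<in> carrier (fib ?M (a + \<epsilon>))" "y \<in> carrier (fib ?M (a + \<epsilon>))" for x y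
    using that by simp
  (* The unit vector of the summand i is compared with the zero vector. *)
  let ?z = "\<lambda>j\<in>I'. \<zero>\<^bsub>K\<^esub>" and ?e = "\<lambda>j\<in>I'. if j = i then \<one>\<^bsub>K\<^esub> else \<zero>\<^bsub>K\<^esub>"
  have z: "?z \<in> carrier (fib ?N a)" and e: "?e \<in> carrier (fib ?N a)"
    using a(1) by (auto simp: finite_direct_sum_def interval_module_def trivial_space_def)
  have "g a ?e = g a ?z" by (intro M0 shift_morphismD(3)[OF g] z e)
  then have "tr ?N a (a + 2 * \<epsilon>) ?e = tr ?N a (a + 2 * \<epsilon>) ?z"
    using fg[OF z] fg[OF e] by simp
  then have "tr ?N a (a + 2 * \<epsilon>) ?e i = tr ?N a (a + 2 * \<epsilon>) ?z i" by simp
  then show False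
    using i a(1,2) by (simp add: finite_direct_sum_def interval_module_def)
qed

section \<open>The path component of the zero module\<close>

lemma uniform_bound_finite_family:
  fixes J :: "nat \<Rightarrow> real set"
  assumes "\<And>i. i < n \<Longrightarrow> bounded (J i)"
  obtains R where "0 < R" "\<And>i x. \<lbrakk>i \<in> {..<n}; x \<in> J i\<rbrakk> \<Longrightarrow> \<bar>x\<bar> \<le> R"
proof -
  have "bounded (\<Union>i\<in>{..<n}. J i)" using assms by (intro bounded_UN) auto
  then obtain R where "0 < R" "\<And>x. x \<in> (\<Union>i\<in>{..<n}. J i) \<Longrightarrow> norm x \<le> R"
    unfolding bounded_pos by blast
  then show thesis by (intro that[of R]) auto
qed

text \<open>
  Used twice: for \<open>n = 0\<close> it exhibits zero as a sum of intervals, and for arbitrary \<open>n\<close> it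
  identifies the starting point of the shrinking path.
\<close>
lemma zero_class_eq_empty_sum:
  assumes "Ring.field K" "\<And>i. i < n \<Longrightarrow> J i = {}"
  shows "iso_class K (finite_direct_sum {..<n} (\<lambda>i. interval_module K (J i))) = iso_class K zero_pmod"
proof (rule iso_class_eqI)
  show "persistence_module K (finite_direct_sum {..<n} (\<lambda>i. interval_module K (J i)))"
    by (rule interval_sum_persistence[OF assms(1)]) (simp add: assms(2))
  show "pmod_iso K (finite_direct_sum {..<n} (\<lambda>i. interval_module K (J i))) zero_pmod"
    by (rule sum_of_empty_intervals_iso_zero) (simp add: assms(2))
qed

theorem proposition4p14:
  fixes K :: "('k, 'm) ring_scheme"
  assumes "Ring.field K"
  shows "path_component_of_set (interleaving_topology K (fid K)) (iso_class K zero_pmod)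
         = ffid K"
proof
  let ?sum = "\<lambda>n J. finite_direct_sum {..<n::nat} (\<lambda>i. interval_module K (J i))"
  let ?zero = "iso_class K zero_pmod"
  note pm = interval_sum_persistence[OF assms]
  interpret extended_pseudometric "fid K" "class_dist K"
  proof (rule extended_pseudometric_class_dist)
    fix A assume "A \<in> fid K"
    then obtain n J where A: "A = iso_class K (?sum n J)" and J: "\<forall>i<n. is_interval (J i) \<and> J i \<noteq> {}"
      unfolding fid_def by blast
    have "persistence_module K (?sum n J)" using J by (auto intro: pm)
    then show "\<exists>M. persistence_module K M \<and> A = iso_class K M" using A by blast
  qed
  have top: "interleaving_topology K (fid K) = ball_topology"
    unfolding interleaving_topology_def ball_topology_def ..
  have ffid_fid: "ffid K \<subseteq> fid K" unfolding ffid_def fid_def by blast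
  have zero: "?zero \<in> ffid K"
  proof -
    have "iso_class K (?sum 0 (\<lambda>_. {})) = ?zero"
      by (rule zero_class_eq_empty_sum[OF assms]) simp
    then show ?thesis
      unfolding ffid_def by (intro CollectI exI[of _ 0] exI[of _ "\<lambda>_. {}"] conjI) (rule sym, simp_all)
  qed
  show "path_component_of_set (interleaving_topology K (fid K)) ?zero \<subseteq> ffid K"
  proof -
    have finite_dist: "B \<in> ffid K"
      if A_ffid: "A \<in> ffid K" and B_fid: "B \<in> fid K" and AB: "class_dist K A B < ereal r" for A B r
    proof -
      obtain n J where A: "A = iso_class K (?sum n J)"
        and J: "\<forall>i<n. is_interval (J i) \<and> J i \<noteq> {} \<and> bounded (J i)"
        using A_ffid unfolding ffid_def by blast
      obtain n' J' where B: "B = iso_class K (?sum n' J')"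
        and J': "\<forall>i<n'. is_interval (J' i) \<and> J' i \<noteq> {}"
        using B_fid unfolding fid_def by blast
      have pms: "persistence_module K (?sum n J)" "persistence_module K (?sum n' J')"
        using J J' by (auto intro!: pm)
      obtain \<epsilon> where \<epsilon>: "0 \<le> \<epsilon>" "interleaved K \<epsilon> (?sum n J) (?sum n' J')"
        using AB unfolding A B class_dist_less_iff[OF pms] by blast
      have "bounded (J i)" if "i < n" for i using J that by simp
      then obtain R where R: "0 < R" "\<And>i x. \<lbrakk>i \<in> {..<n}; x \<in> J i\<rbrakk> \<Longrightarrow> \<bar>x\<bar> \<le> R"
        using uniform_bound_finite_family by metis
      have "bounded (J' i)" if "i < n'" for i
        using J' that by (intro bounded_if_interleaved_with_bounded[OF assms _ R(2) \<epsilon>]) auto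
      then have "\<forall>i<n'. is_interval (J' i) \<and> J' i \<noteq> {} \<and> bounded (J' i)" using J' by simp
      then show ?thesis unfolding ffid_def B by blast
    qed
    have clopen: "openin ball_topology (ffid K)" "closedin ball_topology (ffid K)"
      using clopen_if_closed_under_finite_distance[OF ffid_fid finite_dist] by simp_all
    have "?zero \<in> path_component_of_set ball_topology ?zero"
      using zero ffid_fid by (auto simp: path_component_of_refl topspace_ball_topology)
    then have "\<not> disjnt (path_component_of_set ball_topology ?zero) (ffid K)"
      using zero unfolding disjnt_iff by blast
    moreover have "connectedin ball_topology (path_component_of_set ball_topology ?zero)"
      by (intro path_connectedin_imp_connectedin path_connectedin_path_component_of)
    ultimately show ?thesis
      unfolding top using connectedin_clopen_cases[OF _ clopen(2,1)] by blast
  qed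
  show "ffid K \<subseteq> path_component_of_set (interleaving_topology K (fid K)) ?zero"
  proof
    fix A assume "A \<in> ffid K"
    then obtain n J where A: "A = iso_class K (?sum n J)"
      and J: "\<forall>i<n. is_interval (J i) \<and> J i \<noteq> {} \<and> bounded (J i)"
      unfolding ffid_def by blast
    have "bounded (J i)" if "i < n" for i using J that by simp
    then obtain R where R: "0 < R" "\<And>i x. \<lbrakk>i \<in> {..<n}; x \<in> J i\<rbrakk> \<Longrightarrow> \<bar>x\<bar> \<le> R"
      using uniform_bound_finite_family by metis
    let ?g = "\<lambda>t. iso_class K (?sum n (\<lambda>i. shrink t (J i)))"
    have pmg: "persistence_module K (?sum n (\<lambda>i. shrink t (J i)))" for t
      using J by (auto intro!: pm is_interval_shrink)
    have g0: "?g 0 = ?zero"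
      by (rule zero_class_eq_empty_sum[OF assms]) (simp add: shrink_def)
    have g1: "?g 1 = A" by (simp add: A shrink_1)
    have "pathin ball_topology ?g"
    proof (rule pathin_ball_topologyI)
      fix t :: real
      show "?g t \<in> fid K"
      proof (cases "t = 0")
        case True
        then show ?thesis using g0 zero ffid_fid by auto
      next
        case False
        then have "\<forall>i<n. is_interval (shrink t (J i)) \<and> shrink t (J i) \<noteq> {}"
          using J by (auto simp: shrink_eq_empty_iff intro: is_interval_shrink)
        then show ?thesis
          unfolding fid_def
          by (intro CollectI exI[of _ n] exI[of _ "\<lambda>i. shrink t (J i)"] conjI refl)
      qed
    next
      fix t r :: real assume t: "t \<in> {0..1}" and r: "0 < r"
      have "class_dist K (?g t) (?g s) < ereal r" if s: "s \<in> {0..1}" "\<bar>s - t\<bar> < r / (2 * R)" for s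
      proof -
        have "\<bar>t - s\<bar> * R < r / 2" using s(2) R(1) by (simp add: field_simps abs_minus_commute)
        then have "interleaved K (r / 2) (?sum n (\<lambda>i. shrink t (J i))) (?sum n (\<lambda>i. shrink s (J i)))"
          using J R(2) s t by (intro interleaved_shrink_sum[OF assms]) auto
        then show ?thesis
          unfolding class_dist_less_iff[OF pmg pmg] using r by (intro exI[of _ "r / 2"]) auto
      qed
      then show "\<exists>\<delta>>0. \<forall>s\<in>{0..1}. \<bar>s - t\<bar> < \<delta> \<longrightarrow> class_dist K (?g t) (?g s) < ereal r"
        using r R(1) by (intro exI[of _ "r / (2 * R)"]) auto
    qed
    then show "A \<in> path_component_of_set (interleaving_topology K (fid K)) ?zero"
      unfolding top path_component_of_def using g0 g1 by blast
  qed
qed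

end
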